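(* Let $\mathscr{A}$ be an abelian $C^*$-algebra, let $\mathcal{E}$ be a Hilbert $\mathscr{A}$-module, and let $T,S\in L(\mathcal{E})$. Then: (i) $W_{o}(T^* )=\overline{W_{o}(T)}$, where $\overline{W_o(T)}=\{\bar\lambda:\lambda\in W_o(T)\}$ is the set of complex conjugates of elements of $W_o(T)$. (ii) If $\alpha,\beta\in\mathbb{C}$, then $W_{o}(\alpha T+\beta I_{\mathcal{E}})=\alpha W_{o}(T)+\beta$, where $I_{\mathcal{E}}$ is the identity operator on $\mathcal{E}$ and $\alpha W_o(T)+\beta=\{\alpha\lambda+\beta:\lambda\in W_o(T)\}$. (iii) If $U\in L(\mathcal{E})$ is unitary, then $W_{o}(UTU^* )=W_{o}(T)$. (iv) $W_{o}(T)\subseteq\mathbb{R}$ if and only if $T$ is self-adjoint. (v) $W_{o}(T+S)\subseteq W_{o}(T)+W_{o}(S)$, where $W_o(T)+W_o(S)=\{\lambda+\mu:\lambda\in W_o(T),\ \mu\in W_o(S)\}$.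
   Context: A (right) Hilbert $\mathscr{A}$-module $\mathcal{E}$ is a complex linear space and right $\mathscr{A}$-module with an $\mathscr{A}$-valued inner product $\langle\cdot,\cdot\rangle:\mathcal{E}\times\mathcal{E}\to\mathscr{A}$ satisfying $\langle x,\alpha y+\beta z\rangle=\alpha\langle x,y\rangle+\beta\langle x,z\rangle$, $\langle x,ya\rangle=\langle x,y\rangle a$, $\langle x,y\rangle^*=\langle y,x\rangle$, and $\langle x,x\rangle\ge 0$ with $\langle x,x\rangle=0$ only if $x=0$ (for $x,y,z\in\mathcal{E}$, $a\in\mathscr{A}$, $\alpha,\beta\in\mathbb{C}$), and complete in the norm $\|x\|=\|\langle x,x\rangle\|^{1/2}$. For $x\in\mathcal{E}$ put $|x|=\langle x,x\rangle^{1/2}\in\mathscr{A}$. $L(\mathcal{E})$ denotes the $C^*$-algebra (with the operator norm) of adjointable maps on $\mathcal{E}$: maps $T:\mathcal{E}\to\mathcal{E}$ for which there is a map $T^*:\mathcal{E}\to\mathcal{E}$ with $\langle Tx,y\rangle=\langle x,T^*y\rangle$ for all $x,y\in\mathcal{E}$ (such maps are automatically bounded and $\mathscr{A}$-linear). $T$ is self-adjoint if $T=T^*$; $U$ is unitary if $U^*U=UU^*=I_{\mathcal{E}}$. $\tau(\mathscr{A})$ is the set of characters of $\mathscr{A}$, i.e. nonzero $*$-homomorphisms $\varphi:\mathscr{A}\to\mathbb{C}$ (these have $\|\varphi\|=1$). The numerical range of $T\in L(\mathcal{E})$ is $$W_{o}(T)=\{\varphi(\langle Tx,x\rangle): x\in\mathcal{E},\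 \varphi\in\tau(\mathscr{A}),\ \varphi(|x|)=1\}.$$
   Formalization: In (ii) the formula is corrected to W_o(αT+βI) = ᾱ W_o(T) + β̄, because the inner product is conjugate-linear in its first variable, where T stands; the printed formula fails e.g. for T=0, α=0, β=i on the complex numbers. *)

theory Defs
  imports Complex_Main
begin

class complex_vector = real_vector +
  fixes scaleC :: "complex \<Rightarrow> 'a \<Rightarrow> 'a"  (infixr "*\<^sub>C" 75)
  assumes scaleC_add_right: "c *\<^sub>C (x + y) = c *\<^sub>C x + c *\<^sub>C y"
    and scaleC_add_left: "(c + d) *\<^sub>C x = c *\<^sub>C x + d *\<^sub>C x"
    and scaleC_scaleC: "c *\<^sub>C d *\<^sub>C x = (c * d) *\<^sub>C x"
    and scaleR_scaleC: "scaleR r x = complex_of_real r *\<^sub>C x"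

text \<open>No unit is required, and the zero algebra is not excluded.\<close>

class cstar_algebra = complex_vector + real_normed_algebra + banach +
  fixes star :: "'a \<Rightarrow> 'a"
  assumes scaleC_mult_left: "(c *\<^sub>C a) * b = c *\<^sub>C (a * b)"
    and scaleC_mult_right: "a * (c *\<^sub>C b) = c *\<^sub>C (a * b)"
    and norm_scaleC: "norm (c *\<^sub>C a) = cmod c * norm a"
    and star_star: "star (star a) = a"
    and star_add: "star (a + b) = star a + star b"
    and star_scaleC: "star (c *\<^sub>C a) = cnj c *\<^sub>C star a"
    and star_mult: "star (a * b) = star b * star a"
    and cstar_identity: "norm (star a * a) = (norm a)\<^sup>2"

class abelian_cstar_algebra = cstar_algebra + comm_ring

definition cstar_pos :: "'a::cstar_algebra \<Rightarrow> bool" where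
  "cstar_pos a \<longleftrightarrow> (\<exists>b. a = star b * b)"

text \<open>A positive element of a \<open>C\<close>*-algebra has exactly one positive square root, so the
  description below is proper on positive arguments.\<close>

definition cstar_sqrt :: "'a::cstar_algebra \<Rightarrow> 'a" where
  "cstar_sqrt a = (THE b. cstar_pos b \<and> b * b = a)"

definition characters :: "('a::cstar_algebra \<Rightarrow> complex) set" where
  "characters = {\<phi>.
     (\<forall>a b. \<phi> (a + b) = \<phi> a + \<phi> b) \<and>
     (\<forall>c a. \<phi> (c *\<^sub>C a) = c * \<phi> a) \<and>
     (\<forall>a b. \<phi> (a * b) = \<phi> a * \<phi> b) \<and>
     (\<forall>a. \<phi> (star a) = cnj (\<phi> a)) \<and>
     (\<exists>a. \<phi> a \<noteq> 0)}"

text \<open>Completeness in the norm induced by \<open>ip\<close> is the sort \<open>banach\<close> of the module type together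
  with \<open>norm_ip\<close>. The inner product is linear in the second variable, hence conjugate-linear in
  the first.\<close>

locale hilbert_module =
  fixes act :: "'e::{complex_vector,banach} \<Rightarrow> 'a::cstar_algebra \<Rightarrow> 'e"
    and ip :: "'e \<Rightarrow> 'e \<Rightarrow> 'a"
  assumes act_add_left: "act (x + y) a = act x a + act y a"
    and act_add_right: "act x (a + b) = act x a + act x b"
    and act_mult: "act x (a * b) = act (act x a) b"
    and ip_lin_right: "ip x (\<alpha> *\<^sub>C y + \<beta> *\<^sub>C z) = \<alpha> *\<^sub>C ip x y + \<beta> *\<^sub>C ip x z"
    and ip_act_right: "ip x (act y a) = ip x y * a"
    and star_ip: "star (ip x y) = ip y x"
    and ip_pos: "cstar_pos (ip x x)"
    and ip_definite: "ip x x = 0 \<Longrightarrow> x = 0"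
    and norm_ip: "norm x = sqrt (norm (ip x x))"

definition module_abs :: "('e \<Rightarrow> 'e \<Rightarrow> 'a::cstar_algebra) \<Rightarrow> 'e \<Rightarrow> 'a" where
  "module_abs ip x = cstar_sqrt (ip x x)"

definition adjointable :: "('e \<Rightarrow> 'e \<Rightarrow> 'a) \<Rightarrow> ('e \<Rightarrow> 'e) \<Rightarrow> bool" where
  "adjointable ip T \<longleftrightarrow> (\<exists>T'. \<forall>x y. ip (T x) y = ip x (T' y))"

text \<open>The adjoint of an adjointable map is unique because \<open>ip\<close> is definite.\<close>

definition module_adjoint :: "('e \<Rightarrow> 'e \<Rightarrow> 'a) \<Rightarrow> ('e \<Rightarrow> 'e) \<Rightarrow> 'e \<Rightarrow> 'e" where
  "module_adjoint ip T = (THE T'. \<forall>x y. ip (T x) y = ip x (T' y))"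

definition module_selfadjoint :: "('e \<Rightarrow> 'e \<Rightarrow> 'a) \<Rightarrow> ('e \<Rightarrow> 'e) \<Rightarrow> bool" where
  "module_selfadjoint ip T \<longleftrightarrow> adjointable ip T \<and> T = module_adjoint ip T"

definition module_unitary :: "('e \<Rightarrow> 'e \<Rightarrow> 'a) \<Rightarrow> ('e \<Rightarrow> 'e) \<Rightarrow> bool" where
  "module_unitary ip U \<longleftrightarrow>
     adjointable ip U \<and> module_adjoint ip U \<circ> U = id \<and> U \<circ> module_adjoint ip U = id"

text \<open>The operator stands in the conjugate-linear slot of \<open>ip\<close>, so scalars multiplying \<open>T\<close> come
  out conjugated: the range of \<open>\<alpha>T + \<beta>I\<close> is \<open>cnj \<alpha>\<close> times that of \<open>T\<close>, shifted by \<open>cnj \<beta>\<close>.\<close>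

definition numerical_range :: "('e \<Rightarrow> 'e \<Rightarrow> 'a::cstar_algebra) \<Rightarrow> ('e \<Rightarrow> 'e) \<Rightarrow> complex set" where
  "numerical_range ip T =
     {\<phi> (ip (T x) x) |x \<phi>. \<phi> \<in> characters \<and> \<phi> (module_abs ip x) = 1}"

end

theory Submission imports Defs "HOL-Analysis.Analysis" begin

text \<open>Once \<open>\<phi> \<bar>x\<bar> = 1\<close> is known to mean \<open>\<phi> \<langle>x, x\<rangle> = 1\<close>, everything but the converse in (iv) is formal. For
  that converse, \<open>\<phi> \<langle>T x, x\<rangle>\<close> is real for every character: normalise \<open>x\<close> if \<open>\<phi> \<langle>x, x\<rangle> > 0\<close>, and use
  Cauchy-Schwarz if \<open>\<phi> \<langle>x, x\<rangle> = 0\<close>. As characters separate points, \<open>\<langle>T x, x\<rangle> = \<langle>x, T x\<rangle>\<close>, and one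
  polarises.

  Characters attaining the norm of a given self-adjoint \<open>h\<close> come from a minimal C*-seminorm \<open>p\<close> with
  \<open>p h = norm h\<close>. Minimality forces \<open>p\<close> to be multiplicative, and then a Gelfand-Mazur argument shows
  that \<open>p\<close> is the absolute value of a character. No unit, quotient or ideal is needed. Positive square roots
  are limits of the iteration \<open>s \<mapsto> s + (a - s\<^sup>2) / 2\<close>, which converges uniformly on \<open>[0, 1]\<close>
  and stays inside the non-unital algebra.\<close>

section \<open>Scalars and the involution\<close>

lemma scaleC_one [simp]: "1 *\<^sub>C (x::'a::complex_vector) = x"
  using scaleR_scaleC[of 1 x] by simp

lemma scaleC_zero_left [simp]: "0 *\<^sub>C (x::'a::complex_vector) = 0"
  using scaleR_scaleC[of 0 x] by simp

lemma scaleC_zero_right [simp]: "c *\<^sub>C (0::'a::complex_vector) = 0"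
  using scaleC_add_right[of c 0 0] by simp

lemma scaleC_minus_one: "(-1) *\<^sub>C (x::'a::complex_vector) = - x"
  using scaleR_scaleC[of "-1" x] by simp

lemma scaleC_minus_left: "(- c) *\<^sub>C (x::'a::complex_vector) = - (c *\<^sub>C x)"
  using scaleC_add_left[of "-c" c x] by (simp add: eq_neg_iff_add_eq_0)

lemma scaleC_minus_right: "c *\<^sub>C (- x::'a::complex_vector) = - (c *\<^sub>C x)"
  using scaleC_add_right[of c "-x" x] by (simp add: eq_neg_iff_add_eq_0)

lemma scaleC_diff_left: "(c - d) *\<^sub>C (x::'a::complex_vector) = c *\<^sub>C x - d *\<^sub>C x"
  using scaleC_add_left[of c "-d" x] by (simp add: scaleC_minus_left)

lemma scaleC_diff_right: "c *\<^sub>C (x - y::'a::complex_vector) = c *\<^sub>C x - c *\<^sub>C y"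
  using scaleC_add_right[of c x "-y"] by (simp add: scaleC_minus_right)

lemma star_zero [simp]: "star (0::'a::cstar_algebra) = 0"
  using star_add[of "0::'a" 0] by simp

lemma star_minus: "star (- a::'a::cstar_algebra) = - star a"
  using star_add[of "-a" a] by (simp add: eq_neg_iff_add_eq_0)

lemma star_diff: "star (a - b::'a::cstar_algebra) = star a - star b"
  using star_add[of a "-b"] by (simp add: star_minus)

section \<open>Seminorms satisfying the C*-identity\<close>

text \<open>The bound \<open>le_norm\<close> is carried along so that the characters obtained from
  such a seminorm come out contractive.\<close>

locale cstar_seminorm =
  fixes p :: "'a::abelian_cstar_algebra \<Rightarrow> real"
  assumes nonneg: "p x \<ge> 0"
    and triangle: "p (x + y) \<le> p x + p y"
    and scale: "p (c *\<^sub>C x) = cmod c * p x"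
    and submult: "p (x * y) \<le> p x * p y"
    and cstar: "p (star x * x) = (p x)\<^sup>2"
    and le_norm: "p x \<le> norm x"
begin

lemma zero [simp]: "p 0 = 0"
  using scale[of 0 0] by simp

lemma minus [simp]: "p (- x) = p x"
  using scale[of "-1" x] by (simp add: scaleC_minus_one)

lemma diff_triangle: "p (x - y) \<le> p x + p y"
  using triangle[of x "-y"] by simp

lemma abs_diff_le: "\<bar>p x - p y\<bar> \<le> p (x - y)"
  using triangle[of "x - y" y] triangle[of "y - x" x] minus[of "x - y"] by simp

lemma star_le: "p x \<le> p (star x)"
proof (cases "p x = 0")
  case False
  then have "p x > 0" using nonneg[of x] by simp
  moreover have "p x * p x \<le> p (star x) * p x"
    using submult[of "star x" x] by (simp add: cstar power2_eq_square)
  ultimately show ?thesis by simp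
qed (simp add: nonneg)

lemma p_star [simp]: "p (star x) = p x"
  using star_le[of x] star_le[of "star x"] by (simp add: star_star)

lemma square_selfadjoint: "star e = e \<Longrightarrow> p (e * e) = p e * p e"
  using cstar[of e] by (simp add: power2_eq_square)

end

lemma cstar_seminorm_norm: "cstar_seminorm (norm :: 'a::abelian_cstar_algebra \<Rightarrow> real)"
  by unfold_locales (auto simp: norm_triangle_ineq norm_scaleC norm_mult_ineq cstar_identity)

text \<open>Without a unit \<open>e ^ 0\<close> has no meaning, so powers of \<open>e\<close> appear
  as iterates of multiplication by \<open>e\<close>, applied to some element.\<close>

lemma funpow_mult_left:
  fixes e x y :: "'a::comm_ring"
  shows "((*) e ^^ n) x * y = ((*) e ^^ n) (x * y)"
  by (induction n) (simp_all add: mult_ac)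

lemma funpow_mult_mult:
  fixes e x y :: "'a::comm_ring"
  shows "((*) e ^^ m) x * ((*) e ^^ n) y = ((*) e ^^ (m + n)) (x * y)"
  by (induction m) (simp_all add: mult_ac, induction n, simp_all add: mult_ac)

lemma funpow_mult_star:
  fixes e x :: "'a::abelian_cstar_algebra"
  assumes "star e = e"
  shows "star (((*) e ^^ n) x) = ((*) e ^^ n) (star x)"
  by (induction n) (simp_all add: star_mult assms mult.commute)

lemma funpow_mult_add:
  fixes e x y :: "'a::comm_ring"
  shows "((*) e ^^ n) (x + y) = ((*) e ^^ n) x + ((*) e ^^ n) y"
  by (induction n) (simp_all add: distrib_left)

lemma funpow_mult_scaleC:
  fixes e x :: "'a::cstar_algebra"
  shows "((*) e ^^ n) (c *\<^sub>C x) = c *\<^sub>C ((*) e ^^ n) x"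
  by (induction n) (simp_all add: scaleC_mult_right)

section \<open>Peaks of a seminorm at a self-adjoint element\<close>

context cstar_seminorm
begin

text \<open>Submultiplicativity gives one inequality. For the other, the square of a self-adjoint
  power is the product of its two neighbours, so two consecutive known values force the next; hence
  the induction carries two values.\<close>

lemma selfadjoint_power:
  assumes e: "star e = e" and pos: "p e > 0"
  shows "p (((*) e ^^ n) e) = p e ^ Suc n"
proof -
  define f where "f n = p (((*) e ^^ n) e)" for n
  have "f n = p e ^ Suc n \<and> f (Suc n) = p e ^ Suc (Suc n)" for n
  proof (induction n)
    case 0
    show ?case using square_selfadjoint[OF e] by (simp add: f_def)
  next
    case (Suc n)
    have "p e ^ Suc (Suc n) * p e ^ Suc (Suc n) = f (Suc n) * f (Suc n)"
      using Suc by simp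
    also have "\<dots> = p (((*) e ^^ Suc n) e * ((*) e ^^ Suc n) e)"
      unfolding f_def by (rule square_selfadjoint[symmetric]) (metis e funpow_mult_star)
    also have "((*) e ^^ Suc n) e * ((*) e ^^ Suc n) e
        = ((*) e ^^ Suc (Suc n)) e * ((*) e ^^ n) e"
      unfolding funpow_mult_mult by simp
    also have "p \<dots> \<le> f (Suc (Suc n)) * f n" unfolding f_def by (rule submult)
    also have "f n = p e ^ Suc n" using Suc by simp
    finally have "p e ^ Suc (Suc (Suc n)) * p e ^ Suc n \<le> f (Suc (Suc n)) * p e ^ Suc n"
      by (simp add: mult_ac)
    then have "p e ^ Suc (Suc (Suc n)) \<le> f (Suc (Suc n))"
      using pos by (simp only: mult_le_cancel_right) (simp add: not_less)
    moreover have "f (Suc (Suc n)) \<le> p e * f (Suc n)"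
      using submult[of e "((*) e ^^ Suc n) e"] by (simp add: f_def)
    ultimately show ?case using Suc by simp
  qed
  then show ?thesis by (simp add: f_def)
qed

text \<open>If \<open>p\<close> is the supremum norm on a set of characters, then \<open>peak e\<close> is the supremum norm on
  the subset where \<open>\<bar>e\<bar>\<close> is maximal.\<close>

definition peak :: "'a \<Rightarrow> 'a \<Rightarrow> real" where
  "peak e x = lim (\<lambda>n. p (((*) e ^^ n) x) / p e ^ n)"

text \<open>A further factor \<open>e\<close> multiplies the numerator by at most
  \<open>p e\<close>, so the quotients decrease from \<open>p x\<close> and stay
  nonnegative.\<close>

lemma peak_tendsto:
  assumes pos: "p e > 0"
  shows "(\<lambda>n. p (((*) e ^^ n) x) / p e ^ n) \<longlonglongrightarrow> peak e x"
    and "peak e x \<le> p x"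
proof -
  let ?q = "\<lambda>n. p (((*) e ^^ n) x) / p e ^ n"
  have dec: "decseq ?q"
  proof (rule decseq_SucI)
    fix n
    show "?q (Suc n) \<le> ?q n"
      using submult[of e "((*) e ^^ n) x"] pos by (simp add: divide_simps mult_ac)
  qed
  have lb: "\<forall>n. 0 \<le> ?q n" using pos nonneg by simp
  obtain L where L: "?q \<longlonglongrightarrow> L" using decseq_convergent[OF dec, of 0] lb by blast
  then show lim: "?q \<longlonglongrightarrow> peak e x" by (simp add: peak_def limI)
  show "peak e x \<le> p x" using decseq_ge[OF dec lim, of 0] by simp
qed

lemma peak_seminorm:
  assumes e: "star e = e" and pos: "p e > 0"
  shows "cstar_seminorm (peak e)"
proof -
  let ?q = "\<lambda>x n. p (((*) e ^^ n) x) / p e ^ n"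
  note lim = peak_tendsto(1)[OF pos]
  \<comment> \<open>With 2n factors \<open>e\<close>, each factor of a product can receive n of
    them, so the limit is taken along even indices.\<close>
  have lim2: "(\<lambda>n. ?q x (n + n)) \<longlonglongrightarrow> peak e x" for x
    using LIMSEQ_subseq_LIMSEQ[OF lim[of x], of "\<lambda>n. n + n"]
    by (simp add: strict_mono_def o_def)
  show ?thesis
  proof
    fix x y c
    show "0 \<le> peak e x"
      by (rule LIMSEQ_le_const[OF lim]) (use pos nonneg in simp)
    show "peak e (x + y) \<le> peak e x + peak e y"
    proof (rule LIMSEQ_le[OF lim tendsto_add[OF lim lim]], intro exI allI impI)
      fix n
      show "?q (x + y) n \<le> ?q x n + ?q y n"
        using triangle[of "((*) e ^^ n) x" "((*) e ^^ n) y"] pos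
        by (simp add: funpow_mult_add add_divide_distrib[symmetric] divide_right_mono)
    qed
    have "?q (c *\<^sub>C x) = (\<lambda>n. cmod c * ?q x n)"
      by (simp add: funpow_mult_scaleC scale)
    then show "peak e (c *\<^sub>C x) = cmod c * peak e x"
      using lim[of "c *\<^sub>C x"] tendsto_mult_left[OF lim, of "cmod c" x]
      by (metis LIMSEQ_unique)
    show "peak e (x * y) \<le> peak e x * peak e y"
    proof (rule LIMSEQ_le[OF lim2 tendsto_mult[OF lim lim]], intro exI allI impI)
      fix n
      show "?q (x * y) (n + n) \<le> ?q x n * ?q y n"
        using submult[of "((*) e ^^ n) x" "((*) e ^^ n) y"] pos
        by (simp add: funpow_mult_mult power_add divide_right_mono)
    qed
    have "?q (star x * x) (n + n) = ?q x n * ?q x n" for n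
      using cstar[of "((*) e ^^ n) x"]
      by (simp add: funpow_mult_mult funpow_mult_star[OF e] power_add power2_eq_square)
    then show "peak e (star x * x) = (peak e x)\<^sup>2"
      using lim2[of "star x * x"] tendsto_mult[OF lim lim, of x x]
      by (simp add: power2_eq_square LIMSEQ_unique)
    show "peak e x \<le> norm x"
      using peak_tendsto(2)[OF pos, of x] le_norm[of x] by simp
  qed
qed

text \<open>A factor \<open>e\<close> only shifts the defining sequence by one index. With
  \<open>peak_self\<close> this makes \<open>e\<close> multiplicative for its own peak.\<close>

lemma peak_mult:
  assumes pos: "p e > 0"
  shows "peak e (e * x) = p e * peak e x"
proof -
  have "p (((*) e ^^ n) (e * x)) / p e ^ n = p e * (p (((*) e ^^ Suc n) x) / p e ^ Suc n)" for n
    using pos by (simp add: funpow_swap1)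
  then have "(\<lambda>n. p (((*) e ^^ n) (e * x)) / p e ^ n) \<longlonglongrightarrow> p e * peak e x"
    using tendsto_mult_left[OF LIMSEQ_Suc[OF peak_tendsto(1)[OF pos, of x]], of "p e"] by simp
  then show ?thesis using peak_tendsto(1)[OF pos] LIMSEQ_unique by blast
qed

lemma peak_self:
  assumes e: "star e = e" and pos: "p e > 0"
  shows "peak e e = p e"
proof -
  have "(\<lambda>n. p (((*) e ^^ n) e) / p e ^ n) = (\<lambda>n. p e)"
    using selfadjoint_power[OF e pos] pos by simp
  then show ?thesis by (simp add: peak_def)
qed

text \<open>Multiplicativity of \<open>h\<close> supplies the lower bound that makes the defining
  sequence constant. Peaks taken elsewhere thus keep the value at \<open>h\<close> and stay among
  the competitors for minimality.\<close>

lemma peak_multiplicative_element: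
  assumes pos: "p e > 0" and h: "\<And>x. p (h * x) = p h * p x" and e: "star e = e"
  shows "peak e h = p h"
proof (cases "p h = 0")
  case True
  then show ?thesis
    using peak_tendsto(2)[OF pos, of h] cstar_seminorm.nonneg[OF peak_seminorm[OF e pos], of h]
    by simp
next
  case False
  have "p (((*) e ^^ n) h) = p h * p e ^ n" for n
  proof -
    \<comment> \<open>The extra \<open>p e\<close> pays for the last factor in
      \<open>selfadjoint_power\<close>: n iterations applied to \<open>e\<close> make n + 1
      factors.\<close>
    have "p e * p (((*) e ^^ n) h) = p e * (p h * p e ^ n)"
    proof (rule antisym)
      show "p e * p (((*) e ^^ n) h) \<le> p e * (p h * p e ^ n)"
      proof (rule mult_left_mono)
        show "p (((*) e ^^ n) h) \<le> p h * p e ^ n"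
        proof (induction n)
          case (Suc n)
          have "p (((*) e ^^ Suc n) h) \<le> p e * p (((*) e ^^ n) h)"
            using submult by simp
          also have "\<dots> \<le> p e * (p h * p e ^ n)"
            by (rule mult_left_mono[OF Suc]) (simp add: nonneg)
          finally show ?case by (simp only: power_Suc mult.left_commute)
        qed simp
      qed (simp add: nonneg)
      have "p h * p (((*) e ^^ n) e) = p (((*) e ^^ n) h * e)"
        by (simp only: h[symmetric] mult.commute[of h] funpow_mult_left)
      also have "\<dots> \<le> p (((*) e ^^ n) h) * p e" by (rule submult)
      finally show "p e * (p h * p e ^ n) \<le> p e * p (((*) e ^^ n) h)"
        by (simp add: selfadjoint_power[OF e pos] mult_ac)
    qed
    then show ?thesis using pos by simp
  qed
  then have "(\<lambda>n. p (((*) e ^^ n) h) / p e ^ n) = (\<lambda>n. p h)" using pos by simp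
  then show ?thesis by (simp add: peak_def)
qed

end

text \<open>A minimal seminorm \<open>p\<close> with \<open>p h = norm h\<close> agrees with its peak at \<open>h\<close>, so \<open>h\<close> is
  multiplicative for \<open>p\<close>. Then every peak of \<open>p\<close> still has the value \<open>norm h\<close> at \<open>h\<close>, and by
  minimality \<open>p\<close> agrees with all of its peaks.\<close>

lemma exists_multiplicative_seminorm:
  fixes h :: "'a::abelian_cstar_algebra"
  assumes h: "star h = h" and "h \<noteq> 0"
  shows "\<exists>p. cstar_seminorm p \<and> p h = norm h \<and> (\<forall>x y. p (x * y) = p x * p y)"
proof -
  define A where "A = {p::'a \<Rightarrow> real. cstar_seminorm p \<and> p h = norm h}"
  \<comment> \<open>The order is reversed because \<open>predicate_Zorn\<close> yields maximal
    elements.\<close>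
  let ?P = "\<lambda>p q::'a \<Rightarrow> real. q \<le> p"
  have "\<exists>m\<in>A. \<forall>a\<in>A. ?P m a \<longrightarrow> a = m"
  proof (rule predicate_Zorn)
    show "partial_order_on A (relation_of ?P A)"
      by (rule partial_order_on_relation_ofI) auto
  next
    fix C assume C: "C \<in> Chains (relation_of ?P A)"
    then have CA: "C \<subseteq> A" and tot: "\<And>p q. p \<in> C \<Longrightarrow> q \<in> C \<Longrightarrow> p \<le> q \<or> q \<le> p"
      by (auto simp: Chains_def relation_of_def)
    have sn: "\<And>p. p \<in> C \<Longrightarrow> cstar_seminorm p" and ph: "\<And>p. p \<in> C \<Longrightarrow> p h = norm h"
      using CA by (auto simp: A_def)
    show "\<exists>u\<in>A. \<forall>a\<in>C. ?P a u"
    proof (cases "C = {}")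
      case True
      then show ?thesis
        using cstar_seminorm_norm by (intro bexI[of _ norm]) (auto simp: A_def)
    next
      case False
      define u where "u x = (INF p\<in>C. p x)" for x
      have bdd: "bdd_below ((\<lambda>p. p x) ` C)" for x
        by (rule bdd_belowI2[of _ 0]) (simp add: sn cstar_seminorm.nonneg)
      have ule: "u x \<le> p x" if "p \<in> C" for p x
        unfolding u_def by (rule cINF_lower[OF bdd that])
      have uge: "c \<le> u x" if "\<And>p. p \<in> C \<Longrightarrow> c \<le> p x" for c x
        unfolding u_def by (rule cINF_greatest[OF False that])
      have u0: "0 \<le> u x" for x by (rule uge) (simp add: sn cstar_seminorm.nonneg)
      \<comment> \<open>Of two seminorms, each near the infimum at one of the points, the smaller
        one is near it at both; this uses that \<open>C\<close> is a chain.\<close>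
      have approx: "\<exists>p\<in>C. p x < u x + d \<and> p y < u y + d" if d: "d > 0" for x y d
      proof -
        have "\<exists>p\<in>C. p z < u z + d" for z
          using cINF_less_iff[OF False bdd, of z "u z + d"] d by (simp add: u_def)
        then obtain p q where "p \<in> C" "p x < u x + d" "q \<in> C" "q y < u y + d" by meson
        then show ?thesis
          using tot[of p q] le_funD[of p q y] le_funD[of q p x] by fastforce
      qed
      have "cstar_seminorm u"
      proof
        fix x y :: 'a and c :: complex
        obtain p0 where p0: "p0 \<in> C" using False by blast
        show "0 \<le> u x" by (rule u0)
        show "u (x + y) \<le> u x + u y"
        proof (rule field_le_epsilon)
          fix d :: real assume "d > 0"
          then obtain p where p: "p \<in> C" "p x < u x + d/2" "p y < u y + d/2"
            using approx[of "d/2" x y] by auto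
          then show "u (x + y) \<le> u x + u y + d"
            using ule[OF p(1), of "x + y"] cstar_seminorm.triangle[OF sn[OF p(1)], of x y] by simp
        qed
        show "u (c *\<^sub>C x) = cmod c * u x"
        proof (cases "c = 0")
          case True
          then show ?thesis
            using ule[OF p0, of 0] u0[of 0] cstar_seminorm.zero[OF sn[OF p0]] by simp
        next
          case False
          show ?thesis
          proof (rule antisym)
            have "u (c *\<^sub>C x) / cmod c \<le> u x"
            proof (rule uge)
              fix p assume "p \<in> C"
              then show "u (c *\<^sub>C x) / cmod c \<le> p x"
                using ule[of p "c *\<^sub>C x"] cstar_seminorm.scale[OF sn, of p c x] False
                by (simp add: divide_simps mult_ac)
            qed
            then show "u (c *\<^sub>C x) \<le> cmod c * u x" using False by (simp add: divide_simps mult_ac)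
            show "cmod c * u x \<le> u (c *\<^sub>C x)"
              by (rule uge) (simp add: cstar_seminorm.scale[OF sn] ule mult_left_mono)
          qed
        qed
        \<comment> \<open>Submultiplicativity and half of the C*-identity pass to the infimum alike:
          estimate with error \<open>d\<close>, then let \<open>d\<close> tend to 0.\<close>
        have prod: "u z \<le> u x * u y" if z: "\<And>p. p \<in> C \<Longrightarrow> p z \<le> p x * p y" for x y z
        proof -
          have "u z \<le> (u x + d) * (u y + d)" if d: "d > 0" for d
          proof -
            obtain p where p: "p \<in> C" "p x < u x + d" "p y < u y + d" using approx[OF d] by blast
            have "u z \<le> p z" by (rule ule[OF p(1)])
            also have "\<dots> \<le> p x * p y" by (rule z[OF p(1)])
            also have "\<dots> \<le> (u x + d) * (u y + d)"
              using p u0[of x] d cstar_seminorm.nonneg[OF sn[OF p(1)]] by (intro mult_mono) auto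
            finally show ?thesis .
          qed
          then have "\<forall>\<^sub>F d in at_right 0. u z \<le> (u x + d) * (u y + d)"
            by (simp add: eventually_at_right_less eventually_at_filter)
          moreover have "((\<lambda>d. (u x + d) * (u y + d)) \<longlongrightarrow> (u x + 0) * (u y + 0)) (at_right 0)"
            by (intro tendsto_intros)
          ultimately show ?thesis
            using tendsto_lowerbound[of "\<lambda>d. (u x + d) * (u y + d)" _ "at_right 0"] by fastforce
        qed
        show "u (x * y) \<le> u x * u y"
          by (rule prod) (simp add: cstar_seminorm.submult[OF sn])
        show "u (star x * x) = (u x)\<^sup>2"
        proof (rule antisym)
          show "u (star x * x) \<le> (u x)\<^sup>2"
            unfolding power2_eq_square
            by (rule prod) (simp add: cstar_seminorm.cstar[OF sn] power2_eq_square)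
          show "(u x)\<^sup>2 \<le> u (star x * x)"
            by (rule uge) (simp add: cstar_seminorm.cstar[OF sn] ule u0 power_mono)
        qed
        show "u x \<le> norm x"
          using ule[OF p0, of x] cstar_seminorm.le_norm[OF sn[OF p0], of x] by simp
      qed
      moreover have "u h = norm h"
        using ule uge[of "norm h" h] ph False by (metis antisym ex_in_conv order_refl)
      ultimately have "u \<in> A" by (simp add: A_def)
      then show ?thesis using ule by (intro bexI[of _ u]) (auto simp: le_fun_def)
    qed
  qed
  then obtain p where pA: "p \<in> A" and min: "\<And>q. q \<in> A \<Longrightarrow> q \<le> p \<Longrightarrow> q = p" by blast
  interpret cstar_seminorm p using pA by (simp add: A_def)
  have ph: "p h = norm h" using pA by (simp add: A_def)
  then have posh: "p h > 0" using \<open>h \<noteq> 0\<close> by simp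
  have minimal: "peak e = p" if "star e = e" "p e > 0" "peak e h = p h" for e
    using that ph peak_seminorm peak_tendsto(2)
    by (intro min) (auto simp: A_def le_fun_def)
  have mult_h: "p (h * x) = p h * p x" for x
    using peak_mult[OF posh, of x] minimal[OF h posh peak_self[OF h posh]] by simp
  have mult_sa: "p (e * x) = p e * p x" if e: "star e = e" for e x
  proof (cases "p e = 0")
    case True
    then show ?thesis using submult[of e x] nonneg[of "e * x"] by simp
  next
    case False
    then have pos: "p e > 0" using nonneg[of e] by simp
    then show ?thesis
      using peak_mult[OF pos, of x] minimal[OF e pos peak_multiplicative_element[OF pos mult_h e]]
      by simp
  qed
  have "p (x * y) = p x * p y" for x y
  proof -
    \<comment> \<open>\<open>star x * x\<close> is self-adjoint, so \<open>mult_sa\<close> applies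
      to it, and the C*-identity leads back to \<open>x\<close> and \<open>y\<close>.\<close>
    have "(p (x * y))\<^sup>2 = p ((star x * x) * (star y * y))"
      by (simp add: cstar[symmetric] star_mult mult_ac)
    also have "\<dots> = (p x * p y)\<^sup>2"
      by (subst mult_sa) (simp_all add: star_mult star_star cstar power_mult_distrib)
    finally show ?thesis using nonneg by simp
  qed
  then show ?thesis using ph cstar_seminorm_axioms by blast
qed

section \<open>Characters attaining the norm\<close>

locale multiplicative_seminorm = cstar_seminorm +
  assumes mult: "p (x * y) = p x * p y"
begin

text \<open>Passing to the squares of \<open>a\<close> and \<open>b\<close> replaces \<open>t\<close> by its square and keeps the hypotheses,
  because \<open>a\<^sup>2 - \<mu>\<^sup>2 b\<^sup>2 = (a - \<mu> b) (a + \<mu> b)\<close>.\<close>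

lemma distance_bound:
  assumes "\<And>\<mu>. m \<le> p (a - \<mu> *\<^sub>C b)" and "p a = m" and "m > 0"
    and "cmod l * p b = m * t" and "t \<ge> 0"
  shows "p (a - l *\<^sub>C b) \<le> m * (1 + t ^ (2 ^ k))"
  using assms
proof (induction k arbitrary: a b l m t)
  case 0
  then show ?case
    using diff_triangle[of a "l *\<^sub>C b"] by (simp add: scale algebra_simps)
next
  case (Suc k)
  have fact: "a * a - \<mu>\<^sup>2 *\<^sub>C (b * b) = (a - \<mu> *\<^sub>C b) * (a - (- \<mu>) *\<^sub>C b)" for \<mu>
    by (simp add: algebra_simps scaleC_mult_left scaleC_mult_right scaleC_scaleC
        scaleC_minus_left power2_eq_square)
  have "p (a * a - l\<^sup>2 *\<^sub>C (b * b)) \<le> (m * m) * (1 + (t\<^sup>2) ^ (2 ^ k))"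
  proof (rule Suc.IH)
    fix \<mu>
    \<comment> \<open>Every complex \<open>\<mu>\<close> is a square, so the lower bounds at its two
      roots multiply to one at \<open>\<mu>\<close>.\<close>
    have "m * m \<le> p (a - csqrt \<mu> *\<^sub>C b) * p (a - (- csqrt \<mu>) *\<^sub>C b)"
      using Suc.prems(1,3) nonneg by (intro mult_mono) auto
    then show "m * m \<le> p (a * a - \<mu> *\<^sub>C (b * b))"
      using fact[of "csqrt \<mu>"] by (simp add: mult)
  next
    have "cmod (l\<^sup>2) * p (b * b) = (cmod l * p b) * (cmod l * p b)"
      by (simp add: mult norm_mult power2_eq_square)
    then show "cmod (l\<^sup>2) * p (b * b) = m * m * t\<^sup>2"
      by (simp add: Suc.prems(4) power2_eq_square)
  qed (use Suc.prems in \<open>simp_all add: mult\<close>)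
  \<comment> \<open>The second factor in \<open>fact\<close> has \<open>p\<close>-value at least
    \<open>m\<close>, which cancels afterwards.\<close>
  moreover have "p (a - l *\<^sub>C b) * m \<le> p (a * a - l\<^sup>2 *\<^sub>C (b * b))"
    unfolding fact mult using Suc.prems(1) nonneg by (intro mult_left_mono) auto
  ultimately have "m * p (a - l *\<^sub>C b) \<le> m * (m * (1 + t ^ (2 ^ Suc k)))"
    by (simp add: power_mult[symmetric] mult_ac)
  then show ?case using Suc.prems(3) by simp
qed

text \<open>Here \<open>t\<close> is at most 1/2 in \<open>distance_bound\<close>, so the excess
  \<open>t ^ (2 ^ k)\<close> vanishes as \<open>k\<close> grows. A minimum therefore fills a disc
  whose radius does not depend on its centre.\<close>

lemma minimum_spreads:
  assumes min: "\<And>\<mu>. m \<le> p (a - \<mu> *\<^sub>C b)" and pa: "p a = m" and m: "m > 0"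
    and l: "cmod l * p b \<le> m / 2"
  shows "p (a - l *\<^sub>C b) = m"
proof (rule antisym[OF _ min])
  define t where "t = cmod l * p b / m"
  have t: "0 \<le> t" "t < 1" "cmod l * p b = m * t"
    using l m nonneg by (auto simp: t_def divide_simps)
  have "(\<lambda>k. t ^ (2 ^ k)) \<longlonglongrightarrow> 0"
    using LIMSEQ_subseq_LIMSEQ[OF LIMSEQ_realpow_zero[OF t(1,2)], of "\<lambda>k. 2 ^ k"]
    by (simp add: strict_mono_def o_def)
  then have "(\<lambda>k. m * (1 + t ^ (2 ^ k))) \<longlonglongrightarrow> m * (1 + 0)"
    by (intro tendsto_intros)
  moreover have "p (a - l *\<^sub>C b) \<le> m * (1 + t ^ (2 ^ k))" for k
    by (rule distance_bound[OF min pa m t(3,1)])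
  ultimately show "p (a - l *\<^sub>C b) \<le> m"
    using LIMSEQ_le_const by fastforce
qed

text \<open>Gelfand-Mazur with \<open>b\<close> in place of the unit: the minimum over
  \<open>l\<close> is attained, and a positive one would propagate by equal steps arbitrarily far
  out, where the values grow.\<close>

lemma exists_eigenvalue:
  assumes b: "p b > 0"
  shows "\<exists>l. p (a - l *\<^sub>C b) = 0"
proof -
  define f where "f l = p (a - l *\<^sub>C b)" for l
  have lip: "\<bar>f l - f \<mu>\<bar> \<le> cmod (l - \<mu>) * p b" for l \<mu>
  proof -
    have "a - l *\<^sub>C b - (a - \<mu> *\<^sub>C b) = - ((l - \<mu>) *\<^sub>C b)"
      by (simp add: scaleC_diff_left)
    then show ?thesis
      unfolding f_def using abs_diff_le[of "a - l *\<^sub>C b" "a - \<mu> *\<^sub>C b"] by (simp add: scale)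
  qed
  have grow: "cmod l * p b - p a \<le> f l" for l
    using abs_diff_le[of "l *\<^sub>C b" a] minus[of "a - l *\<^sub>C b"] by (simp add: f_def scale)
  have "continuous_on UNIV f"
  proof (rule continuous_onI)
    fix l e assume e: "(e::real) > 0"
    show "\<exists>d>0. \<forall>\<mu>\<in>UNIV. dist \<mu> l < d \<longrightarrow> dist (f \<mu>) (f l) \<le> e"
    proof (intro exI[of _ "e / p b"] conjI ballI impI)
      show "e / p b > 0" using e b by simp
      fix \<mu> assume "dist \<mu> l < e / p b"
      then show "dist (f \<mu>) (f l) \<le> e"
        using lip[of \<mu> l] b by (simp add: dist_norm divide_simps)
    qed
  qed
  \<comment> \<open>Outside this disc \<open>grow\<close> gives values above
    \<open>p a = f 0\<close>, so a minimum on the disc is global.\<close>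
  then have "continuous_on (cball 0 (2 * p a / p b)) f"
    using continuous_on_subset by blast
  moreover have "cball (0::complex) (2 * p a / p b) \<noteq> {}"
    using b nonneg[of a] by (simp add: not_less)
  ultimately obtain l where lmin: "\<And>\<mu>. \<mu> \<in> cball 0 (2 * p a / p b) \<Longrightarrow> f l \<le> f \<mu>"
    using continuous_attains_inf[OF compact_cball] by blast
  have lmin': "f l \<le> f \<mu>" for \<mu>
  proof (cases "\<mu> \<in> cball 0 (2 * p a / p b)")
    case False
    have "f l \<le> f 0" by (rule lmin) (use b nonneg[of a] in simp)
    also have "f 0 = p a" by (simp add: f_def)
    also have "p a \<le> f \<mu>" using False grow[of \<mu>] b by (simp add: divide_simps)
    finally show ?thesis .
  qed (rule lmin)
  show ?thesis
  proof (rule ccontr)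
    assume none: "\<nexists>l. p (a - l *\<^sub>C b) = 0"
    define m where "m = f l"
    have m: "m > 0" using none nonneg[of "a - l *\<^sub>C b"] by (auto simp: m_def f_def less_le)
    \<comment> \<open>The largest step \<open>minimum_spreads\<close> allows, the same at every
      minimum point.\<close>
    define r where "r = m / (2 * p b)"
    have r: "r > 0" using m b by (simp add: r_def)
    have "f (l + of_real (real n * r)) = m" for n
    proof (induction n)
      case (Suc n)
      let ?l = "l + of_real (real n * r)"
      have shift: "a - ?l *\<^sub>C b - \<mu> *\<^sub>C b = a - (?l + \<mu>) *\<^sub>C b" for \<mu>
        by (simp add: scaleC_add_left algebra_simps)
      have "p (a - ?l *\<^sub>C b - of_real r *\<^sub>C b) = m"
      proof (rule minimum_spreads[OF _ _ m])
        show "m \<le> p (a - ?l *\<^sub>C b - \<mu> *\<^sub>C b)" for \<mu>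
          unfolding shift using lmin'[of "?l + \<mu>"] by (simp add: f_def m_def)
        show "p (a - ?l *\<^sub>C b) = m" using Suc by (simp add: f_def)
        show "cmod (of_real r) * p b \<le> m / 2"
          unfolding norm_of_real using m b by (simp add: r_def)
      qed
      then show ?case unfolding shift f_def by (simp add: algebra_simps)
    qed (simp add: m_def)
    moreover obtain n where n: "real n * r > (m + p a) / p b + cmod l"
      using reals_Archimedean3[OF r] by blast
    moreover have "real n * r - cmod l \<le> cmod (l + of_real (real n * r))"
      using norm_diff_ineq[of "of_real (real n * r)" l] r by (simp add: norm_mult add.commute)
    ultimately have "cmod (l + of_real (real n * r)) * p b - p a \<le> m"
      using grow by metis
    moreover have "(m + p a) / p b < cmod (l + of_real (real n * r))"
      using n \<open>real n * r - cmod l \<le> _\<close> by linarith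
    ultimately show False using b by (simp add: divide_simps)
  qed
qed

text \<open>\<open>h\<close> stands in for the unit: \<open>R x l\<close> says that \<open>x\<close>
  acts on \<open>h\<close> as the scalar \<open>l\<close>, up to an element where \<open>p\<close>
  vanishes. Such an \<open>l\<close> exists by \<open>exists_eigenvalue\<close>, is unique, and
  respects all operations.\<close>

lemma exists_character:
  assumes h: "star h = h" and pos: "p h > 0"
  shows "\<exists>\<phi>\<in>characters. \<forall>x. cmod (\<phi> x) = p x"
proof -
  define R where "R x l \<longleftrightarrow> p (x * h - l *\<^sub>C h) = 0" for x l
  have small: "p x = 0" if "p x \<le> 0" for x using that nonneg[of x] by simp
  have R_norm: "cmod l = p x" if "R x l" for x l
    using abs_diff_le[of "x * h" "l *\<^sub>C h"] that pos by (simp add: R_def mult scale)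
  have R_add: "R (x + y) (l + \<mu>)" if "R x l" "R y \<mu>" for x y l \<mu>
  proof -
    have "(x + y) * h - (l + \<mu>) *\<^sub>C h = (x * h - l *\<^sub>C h) + (y * h - \<mu> *\<^sub>C h)"
      by (simp add: algebra_simps scaleC_add_left)
    then show ?thesis
      using that triangle[of "x * h - l *\<^sub>C h" "y * h - \<mu> *\<^sub>C h"] unfolding R_def
      by (intro small) simp
  qed
  have R_scale: "R (c *\<^sub>C x) (c * l)" if "R x l" for x l c
  proof -
    have "(c *\<^sub>C x) * h - (c * l) *\<^sub>C h = c *\<^sub>C (x * h - l *\<^sub>C h)"
      by (simp add: scaleC_mult_left scaleC_diff_right scaleC_scaleC)
    then show ?thesis using that by (simp add: R_def scale)
  qed
  have R_mult: "R (x * y) (l * \<mu>)" if "R x l" "R y \<mu>" for x y l \<mu>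
  proof -
    have "(x * y) * h - (l * \<mu>) *\<^sub>C h = x * (y * h - \<mu> *\<^sub>C h) + \<mu> *\<^sub>C (x * h - l *\<^sub>C h)"
      by (simp add: algebra_simps scaleC_mult_right scaleC_diff_right scaleC_scaleC)
    then show ?thesis
      using that triangle[of "x * (y * h - \<mu> *\<^sub>C h)" "\<mu> *\<^sub>C (x * h - l *\<^sub>C h)"] unfolding R_def
      by (intro small) (simp add: mult scale)
  qed
  have R_star: "R (star x) (cnj l)" if "R x l" for x l
  proof -
    have "star x * h - cnj l *\<^sub>C h = star (x * h - l *\<^sub>C h)"
      by (simp add: star_diff star_mult star_scaleC h mult.commute)
    then show ?thesis using that by (simp add: R_def)
  qed
  \<comment> \<open>\<open>l - \<mu>\<close> is an eigenvalue of \<open>x - x = 0\<close>, so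
    \<open>R_norm\<close> makes it 0.\<close>
  have R_unique: "l = \<mu>" if "R x l" "R x \<mu>" for x l \<mu>
    using R_norm[OF R_add[OF that(1) R_scale[OF that(2), of "-1"]]] by (simp add: scaleC_minus_one)
  define \<phi> where "\<phi> x = (SOME l. R x l)" for x
  have R_phi: "R x (\<phi> x)" for x
    unfolding \<phi>_def by (rule someI_ex) (unfold R_def, rule exists_eigenvalue[OF pos])
  have phi_eq: "\<phi> x = l" if "R x l" for x l by (rule R_unique[OF R_phi that])
  have norm: "cmod (\<phi> x) = p x" for x by (rule R_norm[OF R_phi])
  have "\<phi> h \<noteq> 0" using norm[of h] pos by auto
  then have "\<phi> \<in> characters"
    unfolding characters_def
    using R_add[OF R_phi R_phi] R_scale[OF R_phi] R_mult[OF R_phi R_phi] R_star[OF R_phi]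
    \<open>\<phi> h \<noteq> 0\<close> by (blast intro: phi_eq)
  then show ?thesis using norm by blast
qed

end

text \<open>Every character is contractive, but building the bound into the set makes this fact
  unnecessary: the contractive characters already determine the norm.\<close>

definition contractive_characters :: "('a::cstar_algebra \<Rightarrow> complex) set" where
  "contractive_characters = {\<phi> \<in> characters. \<forall>x. cmod (\<phi> x) \<le> norm x}"

lemma
  assumes "\<phi> \<in> characters"
  shows character_add: "\<phi> (a + b) = \<phi> a + \<phi> b"
    and character_scaleC: "\<phi> (c *\<^sub>C a) = c * \<phi> a"
    and character_mult: "\<phi> (a * b) = \<phi> a * \<phi> b"
    and character_star: "\<phi> (star a) = cnj (\<phi> a)"
  using assms by (auto simp: characters_def)

lemma character_zero: "\<phi> \<in> characters \<Longrightarrow> \<phi> 0 = 0"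
  using character_scaleC[of \<phi> 0 0] by simp

lemma character_minus: "\<phi> \<in> characters \<Longrightarrow> \<phi> (- a) = - \<phi> a"
  using character_scaleC[of \<phi> "-1" a] by (simp add: scaleC_minus_one)

lemma character_diff: "\<phi> \<in> characters \<Longrightarrow> \<phi> (a - b) = \<phi> a - \<phi> b"
  using character_add[of \<phi> a "-b"] by (simp add: character_minus)

lemma character_scaleR: "\<phi> \<in> characters \<Longrightarrow> \<phi> (r *\<^sub>R a) = of_real r * \<phi> a"
  by (simp add: scaleR_scaleC character_scaleC)

text \<open>The seminorm is chosen at the self-adjoint \<open>star a * a\<close>; the C*-identity
  carries the norm equality back to \<open>a\<close>.\<close>

lemma exists_norming_character:
  fixes a :: "'a::abelian_cstar_algebra"
  assumes "a \<noteq> 0"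
  shows "\<exists>\<phi>\<in>contractive_characters. cmod (\<phi> a) = norm a"
proof -
  let ?h = "star a * a"
  have h: "star ?h = ?h" by (simp add: star_mult star_star)
  have "norm ?h > 0" using assms by (simp only: cstar_identity) simp
  then have "?h \<noteq> 0" by auto
  from exists_multiplicative_seminorm[OF h this] obtain p where
    p: "cstar_seminorm p" "p ?h = norm ?h" and m: "\<forall>x y. p (x * y) = p x * p y" by blast
  interpret cstar_seminorm p by fact
  interpret multiplicative_seminorm p using m by unfold_locales simp
  obtain \<phi> where \<phi>: "\<phi> \<in> characters" "\<forall>x. cmod (\<phi> x) = p x"
    using exists_character[OF h] p(2) \<open>norm ?h > 0\<close> by auto
  have "(p a)\<^sup>2 = (norm a)\<^sup>2" using p(2) by (simp add: cstar cstar_identity)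
  then have "p a = norm a" using nonneg[of a] by simp
  then show ?thesis using \<phi> le_norm by (auto simp: contractive_characters_def)
qed

lemma norm_le_if_characters:
  fixes a :: "'a::abelian_cstar_algebra"
  assumes "\<And>\<phi>. \<phi> \<in> contractive_characters \<Longrightarrow> cmod (\<phi> a) \<le> c" and "c \<ge> 0"
  shows "norm a \<le> c"
  using exists_norming_character[of a] assms by (cases "a = 0") force+

lemma characters_separate:
  fixes a b :: "'a::abelian_cstar_algebra"
  assumes "\<And>\<phi>. \<phi> \<in> contractive_characters \<Longrightarrow> \<phi> a = \<phi> b"
  shows "a = b"
proof -
  have "norm (a - b) \<le> 0"
    using assms by (intro norm_le_if_characters) (auto simp: contractive_characters_def character_diff)
  then show ?thesis by simp
qed

section \<open>Positive square roots\<close>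

text \<open>Formulated over \<open>real_algebra\<close> so that one recursion runs both in the
  algebra and on real character values.\<close>

primrec sqrt_iter :: "'a::real_algebra \<Rightarrow> nat \<Rightarrow> 'a" where
  "sqrt_iter a 0 = 0"
| "sqrt_iter a (Suc n) = sqrt_iter a n + (1/2) *\<^sub>R (a - sqrt_iter a n * sqrt_iter a n)"

text \<open>One step multiplies the error by \<open>1 - (r + s) / 2\<close>, so an error
  \<open>d\<close> becomes at most \<open>d * (1 - d / 2)\<close>. The resulting rate is uniform in
  \<open>t\<close>, which is what later gives convergence in norm.\<close>

lemma sqrt_iter_real:
  fixes t :: real
  assumes "0 \<le> t" "t \<le> 1"
  shows "0 \<le> sqrt_iter t n \<and> sqrt_iter t n \<le> sqrt t \<and> sqrt t - sqrt_iter t n \<le> 2 / (real n + 2)"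
proof (induction n)
  case 0
  show ?case using assms by simp
next
  case (Suc n)
  define r s where "r = sqrt t" and "s = sqrt_iter t n"
  have r: "0 \<le> r" "r \<le> 1" "t = r * r" using assms by (auto simp: r_def)
  have s: "0 \<le> s" "s \<le> r" "r - s \<le> 2 / (real n + 2)" using Suc by (auto simp: r_def s_def)
  have ss: "s * s \<le> r * r" using s by (intro mult_mono) auto
  have step: "sqrt_iter t (Suc n) = s + (r * r - s * s) / 2"
    using r(3) by (simp add: s_def)
  have err: "r - sqrt_iter t (Suc n) = (r - s) * (1 - (r + s) / 2)"
    unfolding step by (simp add: field_simps)
  have e1: "0 \<le> (r - s) * (1 - (r + s) / 2)" using r s by (intro mult_nonneg_nonneg) auto
  define d where "d = 2 / (real n + 2)"
  have d: "r - s \<le> d" "d \<le> 1" using s(3) by (auto simp: d_def)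
  have "(r - s) * (1 - (r + s) / 2) \<le> (r - s) * (1 - (r - s) / 2)"
    using s by (intro mult_left_mono) auto
  also have "\<dots> \<le> d * (1 - d / 2)"
  proof -
    \<comment> \<open>This product is the difference of \<open>u * (1 - u / 2)\<close> at
      \<open>u = d\<close> and \<open>u = r - s\<close>.\<close>
    have "0 \<le> (d - (r - s)) * (1 - (d + (r - s)) / 2)" using d by (intro mult_nonneg_nonneg) auto
    then show ?thesis by (simp add: field_simps)
  qed
  also have "\<dots> \<le> 2 / (real (Suc n) + 2)" by (simp add: d_def divide_simps) (simp add: algebra_simps)
  finally show ?case using e1 err ss s(1) step by (simp add: r_def)
qed

lemma character_sqrt_iter:
  assumes \<phi>: "\<phi> \<in> characters" and t: "\<phi> a = of_real t"
  shows "\<phi> (sqrt_iter a n) = of_real (sqrt_iter t n)"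
  by (induction n)
    (simp_all add: character_zero[OF \<phi>] character_add[OF \<phi>] character_scaleR[OF \<phi>]
      character_diff[OF \<phi>] character_mult[OF \<phi>] t)

text \<open>Contractive characters send \<open>a\<close> into [0, 1], so the uniform real rate
  becomes a Cauchy estimate in norm.\<close>

lemma exists_sqrt_unit_ball:
  fixes a :: "'a::abelian_cstar_algebra"
  assumes pos: "\<And>\<phi>. \<phi> \<in> contractive_characters \<Longrightarrow> \<exists>t\<ge>0. \<phi> a = of_real t"
    and a: "norm a \<le> 1"
  shows "\<exists>s. s * s = a \<and> (\<forall>\<phi>\<in>contractive_characters. \<exists>t\<ge>0. \<phi> s = of_real t)"
proof -
  let ?s = "sqrt_iter a"
  have val: "\<exists>t. 0 \<le> t \<and> t \<le> 1 \<and> (\<forall>n. \<phi> (?s n) = of_real (sqrt_iter t n))"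
    if \<phi>: "\<phi> \<in> contractive_characters" for \<phi>
  proof -
    obtain t where t: "t \<ge> 0" "\<phi> a = of_real t" using pos[OF \<phi>] by blast
    have "cmod (\<phi> a) \<le> 1" using \<phi> a by (auto simp: contractive_characters_def intro: order_trans)
    then show ?thesis
      using t character_sqrt_iter[of \<phi> a t] \<phi> by (auto simp: contractive_characters_def)
  qed
  have close: "norm (?s m - ?s n) \<le> 2 / (real n + 2)" if "n \<le> m" for m n
  proof (rule norm_le_if_characters)
    fix \<phi> :: "'a \<Rightarrow> complex" assume \<phi>: "\<phi> \<in> contractive_characters"
    obtain t where t: "0 \<le> t" "t \<le> 1" "\<forall>n. \<phi> (?s n) = of_real (sqrt_iter t n)"
      using val[OF \<phi>] by blast
    have "2 / (real m + 2) \<le> 2 / (real n + 2)" using that by (simp add: frac_le)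
    then have "\<bar>sqrt_iter t m - sqrt_iter t n\<bar> \<le> 2 / (real n + 2)"
      using sqrt_iter_real[OF t(1,2), of m] sqrt_iter_real[OF t(1,2), of n] by linarith
    then show "cmod (\<phi> (?s m - ?s n)) \<le> 2 / (real n + 2)"
      using \<phi> t(3) character_diff[of \<phi>]
      by (simp add: contractive_characters_def of_real_diff[symmetric] norm_of_real del: of_real_diff)
  qed simp
  have "Cauchy ?s"
  proof (rule CauchyI')
    fix e :: real assume "e > 0"
    obtain M where "2 / e < real M" using reals_Archimedean2 by blast
    then have M: "2 < e * (real M + 2)" using \<open>e > 0\<close> by (simp add: field_simps)
    have "norm (?s m - ?s n) < e" if "M \<le> m" "m < n" for m n
    proof -
      have "norm (?s n - ?s m) \<le> 2 / (real m + 2)" using close that by simp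
      also have "\<dots> \<le> 2 / (real M + 2)" using that by (simp add: frac_le)
      also have "\<dots> < e" using M by (simp add: divide_simps mult_ac)
      finally show ?thesis by (simp add: norm_minus_commute)
    qed
    then show "\<exists>M. \<forall>m\<ge>M. \<forall>n>m. dist (?s m) (?s n) < e" unfolding dist_norm by blast
  qed
  then obtain s where s: "?s \<longlonglongrightarrow> s" using Cauchy_convergent_iff convergent_def by metis
  \<comment> \<open>By the recursion the defect of the square is twice the increment, which tends to
    0.\<close>
  have "(\<lambda>n. 2 *\<^sub>R (?s (Suc n) - ?s n)) \<longlonglongrightarrow> 2 *\<^sub>R (s - s)"
    by (intro tendsto_intros LIMSEQ_Suc s)
  moreover have "(\<lambda>n. a - ?s n * ?s n) \<longlonglongrightarrow> a - s * s"
    by (intro tendsto_intros s)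
  ultimately have "a - s * s = 0" by (auto dest: LIMSEQ_unique)
  moreover have "\<exists>t\<ge>0. \<phi> s = of_real t" if \<phi>: "\<phi> \<in> contractive_characters" for \<phi>
  proof -
    obtain t where t: "0 \<le> t" "t \<le> 1" "\<forall>n. \<phi> (?s n) = of_real (sqrt_iter t n)"
      using val[OF \<phi>] by blast
    have "(\<lambda>n. \<phi> (?s n) - \<phi> s) \<longlonglongrightarrow> 0"
    proof (rule Lim_null_comparison)
      show "\<forall>\<^sub>F n in sequentially. cmod (\<phi> (?s n) - \<phi> s) \<le> norm (?s n - s)"
        using \<phi> by (simp add: contractive_characters_def flip: character_diff)
      show "(\<lambda>n. norm (?s n - s)) \<longlonglongrightarrow> 0"
        by (rule tendsto_norm_zero[OF LIM_zero[OF s]])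
    qed
    then have lim: "(\<lambda>n. \<phi> (?s n)) \<longlonglongrightarrow> \<phi> s" by (rule LIM_zero_cancel)
    have "Im (\<phi> s) = 0"
      using LIMSEQ_unique[OF tendsto_Im[OF lim]] t(3) by simp
    moreover have "0 \<le> Re (\<phi> s)"
      by (rule LIMSEQ_le_const[OF tendsto_Re[OF lim]]) (simp add: t(3) sqrt_iter_real[OF t(1,2)])
    ultimately show ?thesis by (intro exI[of _ "Re (\<phi> s)"]) (simp add: complex_eq_iff)
  qed
  ultimately show ?thesis by (intro exI[of _ s]) simp
qed

lemma exists_sqrt:
  fixes a :: "'a::abelian_cstar_algebra"
  assumes pos: "\<And>\<phi>. \<phi> \<in> contractive_characters \<Longrightarrow> \<exists>t\<ge>0. \<phi> a = of_real t"
  shows "\<exists>s. s * s = a \<and> (\<forall>\<phi>\<in>contractive_characters. \<exists>t\<ge>0. \<phi> s = of_real t)"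
proof -
  \<comment> \<open>Adding 1 keeps the divisor positive when \<open>a = 0\<close>.\<close>
  define c where "c = norm a + 1"
  have c: "c > 0" by (simp add: c_def add_nonneg_pos)
  have scaled: "\<exists>t\<ge>0. \<phi> (r *\<^sub>R x) = of_real t"
    if \<phi>: "\<phi> \<in> contractive_characters" and r: "r \<ge> 0" and x: "\<exists>t\<ge>0. \<phi> x = of_real t"
    for \<phi> r and x :: 'a
  proof -
    obtain t where t: "t \<ge> 0" "\<phi> x = of_real t" using x by (elim exE conjE)
    have "\<phi> (r *\<^sub>R x) = of_real (r * t)"
      using \<phi> character_scaleR[of \<phi> r x] t(2) by (simp add: contractive_characters_def)
    moreover have "0 \<le> r * t" using r t(1) by (rule mult_nonneg_nonneg)
    ultimately show ?thesis by blast
  qed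
  have "norm ((1 / c) *\<^sub>R a) \<le> 1" using c by (simp add: c_def)
  moreover have "\<exists>t\<ge>0. \<phi> ((1 / c) *\<^sub>R a) = of_real t" if "\<phi> \<in> contractive_characters" for \<phi>
    using scaled[OF that _ pos[OF that], of "1 / c"] c by simp
  ultimately obtain s where s: "s * s = (1 / c) *\<^sub>R a"
    "\<forall>\<phi>\<in>contractive_characters. \<exists>t\<ge>0. \<phi> s = of_real t"
    using exists_sqrt_unit_ball by meson
  have "(sqrt c *\<^sub>R s) * (sqrt c *\<^sub>R s) = a" using s(1) c by simp
  moreover have "\<exists>t\<ge>0. \<phi> (sqrt c *\<^sub>R s) = of_real t" if "\<phi> \<in> contractive_characters" for \<phi>
    using scaled[OF that _ bspec[OF s(2) that], of "sqrt c"] c by simp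
  ultimately show ?thesis by blast
qed

section \<open>Positivity and square roots tested on characters\<close>

lemma character_cstar_pos:
  assumes "\<phi> \<in> characters" "cstar_pos a"
  shows "\<exists>t\<ge>0. \<phi> a = of_real t"
proof -
  obtain b where "a = star b * b" using assms(2) by (auto simp: cstar_pos_def)
  then have "\<phi> a = of_real ((cmod (\<phi> b))\<^sup>2)"
    using assms(1)
    by (simp add: character_mult character_star complex_norm_square mult.commute del: of_real_power)
  then show ?thesis by (metis zero_le_power2)
qed

text \<open>A root with real character values is self-adjoint because characters separate points, so
  its square has the form \<open>star s * s\<close>.\<close>

lemma cstar_pos_if_characters:
  fixes a :: "'a::abelian_cstar_algebra"
  assumes "\<And>\<phi>. \<phi> \<in> contractive_characters \<Longrightarrow> \<exists>t\<ge>0. \<phi> a = of_real t"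
  shows "cstar_pos a"
proof -
  obtain s where s: "s * s = a" "\<forall>\<phi>\<in>contractive_characters. \<exists>t\<ge>0. \<phi> s = of_real t"
    using exists_sqrt[of a] assms by blast
  have "star s = s"
  proof (rule characters_separate)
    fix \<phi> :: "'a \<Rightarrow> complex" assume \<phi>: "\<phi> \<in> contractive_characters"
    then obtain t where "\<phi> s = of_real t" using s(2) by blast
    then show "\<phi> (star s) = \<phi> s"
      using \<phi> by (simp add: contractive_characters_def character_star)
  qed
  then show ?thesis unfolding cstar_pos_def using s(1) by metis
qed

text \<open>Justifies the definite description: two positive roots agree at every contractive
  character, where nonnegative reals have only one nonnegative root.\<close>

lemma cstar_sqrt:
  fixes a :: "'a::abelian_cstar_algebra"
  assumes "cstar_pos a"
  shows "cstar_pos (cstar_sqrt a)" "cstar_sqrt a * cstar_sqrt a = a"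
proof -
  have "\<exists>!b. cstar_pos b \<and> b * b = a"
  proof (rule ex_ex1I)
    show "\<exists>b. cstar_pos b \<and> b * b = a"
      using exists_sqrt[of a] character_cstar_pos[OF _ assms] cstar_pos_if_characters
      by (auto simp: contractive_characters_def)
  next
    fix b c assume b: "cstar_pos b \<and> b * b = a" and c: "cstar_pos c \<and> c * c = a"
    show "b = c"
    proof (rule characters_separate)
      fix \<phi> :: "'a \<Rightarrow> complex" assume "\<phi> \<in> contractive_characters"
      then have \<phi>: "\<phi> \<in> characters" by (simp add: contractive_characters_def)
      obtain t u where t: "t \<ge> 0" "\<phi> b = of_real t" and u: "u \<ge> 0" "\<phi> c = of_real u"
        using character_cstar_pos[OF \<phi>] b c by meson
      have "\<phi> b * \<phi> b = \<phi> c * \<phi> c"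
        using b c character_mult[OF \<phi>] by metis
      then have "t\<^sup>2 = u\<^sup>2"
        unfolding t u by (simp add: power2_eq_square flip: of_real_mult)
      then show "\<phi> b = \<phi> c" using t u by simp
    qed
  qed
  from theI'[OF this] show "cstar_pos (cstar_sqrt a)" "cstar_sqrt a * cstar_sqrt a = a"
    by (auto simp: cstar_sqrt_def)
qed

lemma character_cstar_sqrt_eq_1:
  fixes a :: "'a::abelian_cstar_algebra"
  assumes \<phi>: "\<phi> \<in> characters" and a: "cstar_pos a"
  shows "\<phi> (cstar_sqrt a) = 1 \<longleftrightarrow> \<phi> a = 1"
proof -
  obtain t where t: "t \<ge> 0" "\<phi> (cstar_sqrt a) = of_real t"
    using character_cstar_pos[OF \<phi> cstar_sqrt(1)[OF a]] by blast
  have "\<phi> a = of_real (t\<^sup>2)"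
    using character_mult[OF \<phi>, of "cstar_sqrt a" "cstar_sqrt a"] cstar_sqrt(2)[OF a] t(2)
    by (simp add: power2_eq_square)
  then show ?thesis using t by (simp add: power2_eq_1_iff del: of_real_power)
qed

section \<open>Hilbert modules over an abelian C*-algebra\<close>

context hilbert_module
begin

lemma ip_add_right: "ip x (y + z) = ip x y + ip x z"
  using ip_lin_right[of x 1 y 1 z] by simp

lemma ip_scaleC_right: "ip x (c *\<^sub>C y) = c *\<^sub>C ip x y"
  using ip_lin_right[of x c y 0 0] by simp

lemma ip_add_left: "ip (x + y) z = ip x z + ip y z"
  using star_ip[of z "x + y"] by (simp add: ip_add_right star_add star_ip)

lemma ip_scaleC_left: "ip (c *\<^sub>C x) y = cnj c *\<^sub>C ip x y"
  using star_ip[of y "c *\<^sub>C x"] by (simp add: ip_scaleC_right star_scaleC star_ip)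

lemma ip_diff_right: "ip x (y - z) = ip x y - ip x z"
  using ip_add_right[of x "y - z" z] by simp

lemma ip_right_eqI:
  assumes "\<And>x. ip x y = ip x z"
  shows "y = z"
  using ip_definite[of "y - z"] assms by (simp add: ip_diff_right)

lemma module_adjoint_eqI:
  assumes "\<And>x y. ip (T x) y = ip x (T' y)"
  shows "module_adjoint ip T = T'"
  unfolding module_adjoint_def
  by (rule the_equality) (use assms in \<open>auto intro!: ext ip_right_eqI\<close>)

lemma module_adjoint:
  assumes "adjointable ip T"
  shows "ip (T x) y = ip x (module_adjoint ip T y)"
  using assms module_adjoint_eqI[of T] unfolding adjointable_def by metis

lemma module_adjoint_right:
  assumes "adjointable ip T"
  shows "ip (module_adjoint ip T x) y = ip x (T y)"
  using module_adjoint[OF assms, of y x] star_ip by metis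

text \<open>The quadratic term in \<open>x\<close> vanishes, so a nonzero cross term would let a
  multiple of \<open>x\<close> added to \<open>y\<close> make \<open>\<phi> (ip w w)\<close>
  negative.\<close>

lemma character_ip_isotropic:
  assumes \<phi>: "\<phi> \<in> characters" and x: "\<phi> (ip x x) = 0"
  shows "\<phi> (ip y x) = 0"
proof (rule ccontr)
  define z where "z = \<phi> (ip y x)"
  assume "\<phi> (ip y x) \<noteq> 0"
  then have z: "(cmod z)\<^sup>2 > 0" by (simp add: z_def)
  have zx: "\<phi> (ip x y) = cnj z"
    using character_star[OF \<phi>, of "ip y x"] by (simp add: star_ip z_def)
  \<comment> \<open>Chosen so that the real part of \<open>\<phi> (ip w w)\<close> becomes
    -1.\<close>
  define t where "t = (Re (\<phi> (ip y y)) + 1) / (2 * (cmod z)\<^sup>2)"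
  define w where "w = y + (- of_real t * cnj z) *\<^sub>C x"
  have "\<phi> (ip w w) = \<phi> (ip y y) - of_real (2 * t) * (z * cnj z)"
    unfolding w_def
    by (simp add: ip_add_left ip_add_right ip_scaleC_left ip_scaleC_right character_add[OF \<phi>]
        character_scaleC[OF \<phi>] x zx z_def[symmetric] algebra_simps)
  also have "z * cnj z = of_real ((cmod z)\<^sup>2)" by (simp only: complex_norm_square)
  finally have "Re (\<phi> (ip w w)) = Re (\<phi> (ip y y)) - 2 * t * (cmod z)\<^sup>2"
    by (simp del: of_real_power of_real_mult add: of_real_mult[symmetric])
  also have "2 * t * (cmod z)\<^sup>2 = Re (\<phi> (ip y y)) + 1" using z by (simp add: t_def)
  finally show False using character_cstar_pos[OF \<phi> ip_pos, of w] by auto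
qed

lemma adjointable_add:
  assumes "adjointable ip T"
  shows "T (x + y) = T x + T y"
  using module_adjoint_right[OF assms] by (intro ip_right_eqI) (metis ip_add_right)

lemma adjointable_scaleC:
  assumes "adjointable ip T"
  shows "T (c *\<^sub>C x) = c *\<^sub>C T x"
  using module_adjoint_right[OF assms] by (intro ip_right_eqI) (metis ip_scaleC_right)

text \<open>The form \<open>ip (T x) y - ip x (T y)\<close> vanishes on the diagonal, hence is
  antisymmetric. It is also conjugate-linear in \<open>x\<close> and linear in \<open>y\<close>, so
  replacing \<open>y\<close> by \<open>\<i>\<close> times \<open>y\<close> forces it to be
  0.\<close>

lemma selfadjoint_if_diagonal:
  assumes T: "adjointable ip T" and diag: "\<And>x. ip (T x) x = ip x (T x)"
  shows "module_selfadjoint ip T"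
proof -
  have "ip (T x) y = ip x (T y)" for x y
  proof -
    have pol: "ip (T x) z - ip x (T z) = - (ip (T z) x - ip z (T x))" for z
      using diag[of "x + z"] diag[of x] diag[of z]
      by (simp add: adjointable_add[OF T] ip_add_left ip_add_right algebra_simps)
    define B where "B = ip (T x) y - ip x (T y)"
    have "\<i> *\<^sub>C B = - (cnj \<i> *\<^sub>C (ip (T y) x - ip y (T x)))"
      using pol[of "\<i> *\<^sub>C y"]
      by (simp only: B_def adjointable_scaleC[OF T] ip_scaleC_left ip_scaleC_right scaleC_diff_right)
    also have "ip (T y) x - ip y (T x) = - B"
      using pol[of y] by (simp add: B_def)
    finally have "\<i> *\<^sub>C B = - (\<i> *\<^sub>C B)"
      by (simp add: scaleC_minus_left scaleC_minus_right)
    then have "\<i> *\<^sub>C B + \<i> *\<^sub>C B = 0" by (simp only: eq_neg_iff_add_eq_0)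
    then have "\<i> *\<^sub>C B = 0" by (simp flip: scaleR_2)
    then have "(- \<i>) *\<^sub>C (\<i> *\<^sub>C B) = 0" by simp
    then have "B = 0" by (simp add: scaleC_scaleC)
    then show ?thesis by (simp add: B_def)
  qed
  then show ?thesis
    using T module_adjoint_eqI[of T T] by (simp add: module_selfadjoint_def)
qed

end

section \<open>Numerical ranges over an abelian algebra\<close>

locale abelian_hilbert_module = hilbert_module act ip
  for act :: "'e::{complex_vector,banach} \<Rightarrow> 'a::abelian_cstar_algebra \<Rightarrow> 'e"
    and ip :: "'e \<Rightarrow> 'e \<Rightarrow> 'a"
begin

text \<open>The index set is the same for every operator, so adjoints and affine combinations need
  only a comparison of values at each pair.\<close>

lemma numerical_range_eq:
  "numerical_range ip T
    = (\<lambda>(x, \<phi>). \<phi> (ip (T x) x)) ` {(x, \<phi>). \<phi> \<in> characters \<and> \<phi> (ip x x) = 1}"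
  unfolding numerical_range_def module_abs_def using character_cstar_sqrt_eq_1[OF _ ip_pos] by auto

lemma mem_numerical_range:
  "l \<in> numerical_range ip T
    \<longleftrightarrow> (\<exists>x. \<exists>\<phi>\<in>characters. \<phi> (ip x x) = 1 \<and> l = \<phi> (ip (T x) x))"
  unfolding numerical_range_eq by auto

lemma numerical_range_adjoint:
  assumes "adjointable ip T"
  shows "numerical_range ip (module_adjoint ip T) = cnj ` numerical_range ip T"
proof -
  have "\<phi> (ip (module_adjoint ip T x) x) = cnj (\<phi> (ip (T x) x))" if "\<phi> \<in> characters" for \<phi> x
    using character_star[OF that, of "ip (T x) x"] module_adjoint_right[OF assms, of x x]
    by (simp add: star_ip)
  then show ?thesis
    unfolding numerical_range_eq image_image by (intro image_cong) auto
qed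

lemma numerical_range_affine:
  "numerical_range ip (\<lambda>x. \<alpha> *\<^sub>C T x + \<beta> *\<^sub>C x)
    = {cnj \<alpha> * l + cnj \<beta> |l. l \<in> numerical_range ip T}"
proof -
  have "\<phi> (ip (\<alpha> *\<^sub>C T x + \<beta> *\<^sub>C x) x) = cnj \<alpha> * \<phi> (ip (T x) x) + cnj \<beta>"
    if "\<phi> \<in> characters" "\<phi> (ip x x) = 1" for \<phi> x
    using that
    by (simp add: ip_add_left ip_scaleC_left character_add character_scaleC)
  then show ?thesis
    unfolding Setcompr_eq_image numerical_range_eq image_image by (intro image_cong) auto
qed

text \<open>The adjoint of \<open>U\<close> is a bijection preserving \<open>ip x x\<close>, and
  substituting it for the vector turns one range into the other.\<close>

lemma numerical_range_unitary:
  assumes "module_unitary ip U"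
  shows "numerical_range ip (U \<circ> T \<circ> module_adjoint ip U) = numerical_range ip T"
proof -
  let ?V = "module_adjoint ip U"
  have U: "adjointable ip U" and VU: "?V (U x) = x" and UV: "U (?V x) = x" for x
    using assms by (auto simp: module_unitary_def fun_eq_iff)
  have diag: "ip ((U \<circ> T \<circ> ?V) x) x = ip (T (?V x)) (?V x)" for x
    using module_adjoint[OF U] by simp
  have len: "ip (?V x) (?V x) = ip x x" for x
    using module_adjoint[OF U, of "?V x" x] by (simp add: UV)
  show ?thesis
    unfolding set_eq_iff mem_numerical_range diag using len VU by metis
qed

lemma numerical_range_real_iff:
  assumes T: "adjointable ip T"
  shows "numerical_range ip T \<subseteq> \<real> \<longleftrightarrow> module_selfadjoint ip T"
proof
  assume "module_selfadjoint ip T"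
  have "cnj (\<phi> (ip (T x) x)) = \<phi> (ip (T x) x)" if "\<phi> \<in> characters" for \<phi> x
    using character_star[OF that, of "ip (T x) x"] module_adjoint[OF T, of x x]
      \<open>module_selfadjoint ip T\<close>
    by (simp add: star_ip module_selfadjoint_def)
  then show "numerical_range ip T \<subseteq> \<real>"
    by (auto simp: mem_numerical_range Reals_cnj_iff)
next
  assume real: "numerical_range ip T \<subseteq> \<real>"
  have "ip (T x) x = ip x (T x)" for x
  proof (rule characters_separate)
    fix \<phi> :: "'a \<Rightarrow> complex" assume "\<phi> \<in> contractive_characters"
    then have \<phi>: "\<phi> \<in> characters" by (simp add: contractive_characters_def)
    obtain t where t: "t \<ge> 0" "\<phi> (ip x x) = of_real t"
      using character_cstar_pos[OF \<phi> ip_pos] by blast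
    have "\<phi> (ip (T x) x) \<in> \<real>"
    proof (cases "t = 0")
      case True
      then show ?thesis using character_ip_isotropic[OF \<phi>, of x "T x"] t by simp
    next
      case False
      \<comment> \<open>Scaling by \<open>c\<close> normalises the vector at \<open>\<phi>\<close>
        and multiplies the value in question by the real number \<open>1 / t\<close>.\<close>
      define c :: complex where "c = of_real (1 / sqrt t)"
      have c: "cnj c * c = of_real (1 / t)"
        using t(1) by (simp add: c_def flip: of_real_mult)
      have diag: "\<phi> (ip (c *\<^sub>C y) (c *\<^sub>C x)) = of_real (1 / t) * \<phi> (ip y x)" for y
        using c
        by (simp only: ip_scaleC_left ip_scaleC_right character_scaleC[OF \<phi>] mult.assoc[symmetric]
            mult.commute[of c])
      have "\<phi> (ip (c *\<^sub>C x) (c *\<^sub>C x)) = 1" using diag[of x] t(2) False by simp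
      then have "\<phi> (ip (T (c *\<^sub>C x)) (c *\<^sub>C x)) \<in> \<real>"
        using real \<phi> mem_numerical_range by blast
      then have "of_real (1 / t) * \<phi> (ip (T x) x) \<in> \<real>"
        by (simp only: adjointable_scaleC[OF T] diag)
      then have "of_real t * (of_real (1 / t) * \<phi> (ip (T x) x)) \<in> \<real>"
        by (rule Reals_mult[OF Reals_of_real])
      moreover have "of_real t * (of_real (1 / t) * \<phi> (ip (T x) x)) = \<phi> (ip (T x) x)"
        using False by simp
      ultimately show ?thesis by (simp only:)
    qed
    then show "\<phi> (ip (T x) x) = \<phi> (ip x (T x))"
      using character_star[OF \<phi>, of "ip (T x) x"] by (simp add: star_ip Reals_cnj_iff)
  qed
  then show "module_selfadjoint ip T" by (rule selfadjoint_if_diagonal[OF T])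
qed

lemma numerical_range_add:
  "numerical_range ip (\<lambda>x. T x + S x)
    \<subseteq> {l + m |l m. l \<in> numerical_range ip T \<and> m \<in> numerical_range ip S}"
proof
  fix k assume "k \<in> numerical_range ip (\<lambda>x. T x + S x)"
  then obtain x \<phi> where \<phi>: "\<phi> \<in> characters" "\<phi> (ip x x) = 1" and k: "k = \<phi> (ip (T x + S x) x)"
    unfolding mem_numerical_range by (elim exE bexE conjE)
  have "k = \<phi> (ip (T x) x) + \<phi> (ip (S x) x)"
    by (simp add: k ip_add_left character_add[OF \<phi>(1)])
  moreover have "\<phi> (ip (R x) x) \<in> numerical_range ip R" for R
    unfolding mem_numerical_range using \<phi> by (intro exI bexI conjI) auto
  ultimately show "k \<in> {l + m |l m. l \<in> numerical_range ip T \<and> m \<in> numerical_range ip S}"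
    by (intro CollectI exI conjI)
qed

end

theorem theorem3p2:
  fixes act :: "'e::{complex_vector,banach} \<Rightarrow> 'a::abelian_cstar_algebra \<Rightarrow> 'e"
    and ip :: "'e \<Rightarrow> 'e \<Rightarrow> 'a"
    and T S :: "'e \<Rightarrow> 'e"
  assumes "hilbert_module act ip"
    and "adjointable ip T"
    and "adjointable ip S"
  shows "numerical_range ip (module_adjoint ip T) = cnj ` numerical_range ip T
    \<and> (\<forall>\<alpha> \<beta>. numerical_range ip (\<lambda>x. \<alpha> *\<^sub>C T x + \<beta> *\<^sub>C x)
          = {cnj \<alpha> * l + cnj \<beta> |l. l \<in> numerical_range ip T})
    \<and> (\<forall>U. module_unitary ip U \<longrightarrow>
          numerical_range ip (U \<circ> T \<circ> module_adjoint ip U) = numerical_range ip T)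
    \<and> (numerical_range ip T \<subseteq> \<real> \<longleftrightarrow> module_selfadjoint ip T)
    \<and> numerical_range ip (\<lambda>x. T x + S x)
        \<subseteq> {l + m |l m. l \<in> numerical_range ip T \<and> m \<in> numerical_range ip S}"
proof -
  interpret abelian_hilbert_module act ip
    using assms(1) by (rule abelian_hilbert_module.intro)
  show ?thesis
    by (intro conjI allI impI numerical_range_adjoint[OF assms(2)] numerical_range_affine
      numerical_range_unitary numerical_range_real_iff[OF assms(2)] numerical_range_add)
qed

end
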